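(* Let $T_1,T_2,S_1,S_2:L^1\to L^1$ be positive contractions such that $T_i\leq S_i$ for $i=1,2$ and $S_1S_2=S_2S_1$. If there is an $n_0\in\mathbb{N}$ such that $\|S_1S_2^{n_0}-T_1T_2^{n_0}\|<1$, then $\|S_1S_2^{n}-T_1T_2^{n}\|<1$ for every $n\geq n_0$.
   Context: $(X,\mathcal{F},\mu)$ is a measure space with a positive $\sigma$-additive measure $\mu$, and $L^1=L^1(X,\mathcal{F},\mu)$ is the usual (real) $L^1$ space with its usual norm and pointwise a.e. order. A linear operator $T:L^1\to L^1$ is positive if $Tf\geq 0$ whenever $f\geq 0$; it is a positive contraction if it is positive and $\|T\|\leq 1$ (operator norm). For positive contractions $T,S$ on $L^1$, $T\leq S$ means that $S-T$ is a positive operator. $\mathbb{N}=\{1,2,\dots\}$. *)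

theory Defs
  imports "HOL-Analysis.Analysis"
begin

text \<open>
  The space \<open>L\<^sup>1(M)\<close> of a measure \<open>M\<close> is represented by its integrable representatives: its elements
  are the real functions \<open>f\<close> with \<^term>\<open>integrable M f\<close>, and all equalities and inequalities between
  elements hold almost everywhere. No finiteness condition is imposed on \<open>M\<close>.

  An operator on \<open>L\<^sup>1(M)\<close> is a map on representatives that respects equality almost everywhere, so
  these maps, up to equality a.e. of all values, are exactly the maps on equivalence classes. Values
  at non-integrable functions are irrelevant and are never used.
\<close>

definition L1 :: "'a measure \<Rightarrow> ('a \<Rightarrow> real) set" where
  "L1 M = {f. integrable M f}"

definition L1_norm :: "'a measure \<Rightarrow> ('a \<Rightarrow> real) \<Rightarrow> real" where
  "L1_norm M f = (LINT x|M. \<bar>f x\<bar>)"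

definition L1_linear_operator ::
    "'a measure \<Rightarrow> (('a \<Rightarrow> real) \<Rightarrow> ('a \<Rightarrow> real)) \<Rightarrow> bool" where
  "L1_linear_operator M T \<longleftrightarrow>
     (\<forall>f\<in>L1 M. T f \<in> L1 M) \<and>
     (\<forall>f\<in>L1 M. \<forall>g\<in>L1 M. (AE x in M. f x = g x) \<longrightarrow> (AE x in M. T f x = T g x)) \<and>
     (\<forall>f\<in>L1 M. \<forall>g\<in>L1 M. AE x in M. T (\<lambda>y. f y + g y) x = T f x + T g x) \<and>
     (\<forall>c. \<forall>f\<in>L1 M. AE x in M. T (\<lambda>y. c * f y) x = c * T f x)"

definition L1_positive_operator ::
    "'a measure \<Rightarrow> (('a \<Rightarrow> real) \<Rightarrow> ('a \<Rightarrow> real)) \<Rightarrow> bool" where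
  "L1_positive_operator M T \<longleftrightarrow>
     L1_linear_operator M T \<and>
     (\<forall>f\<in>L1 M. (AE x in M. 0 \<le> f x) \<longrightarrow> (AE x in M. 0 \<le> T f x))"

text \<open>
  The operator norm is a supremum in \<^typ>\<open>ennreal\<close>, so that it is \<open>\<infinity>\<close> for an unbounded operator, where
  a supremum in \<^typ>\<open>real\<close> would be unspecified.
\<close>

definition L1_opnorm ::
    "'a measure \<Rightarrow> (('a \<Rightarrow> real) \<Rightarrow> ('a \<Rightarrow> real)) \<Rightarrow> ennreal" where
  "L1_opnorm M T = (SUP f\<in>{f \<in> L1 M. L1_norm M f \<le> 1}. ennreal (L1_norm M (T f)))"

definition L1_positive_contraction ::
    "'a measure \<Rightarrow> (('a \<Rightarrow> real) \<Rightarrow> ('a \<Rightarrow> real)) \<Rightarrow> bool" where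
  "L1_positive_contraction M T \<longleftrightarrow> L1_positive_operator M T \<and> L1_opnorm M T \<le> 1"

definition op_diff ::
    "(('a \<Rightarrow> real) \<Rightarrow> ('a \<Rightarrow> real)) \<Rightarrow> (('a \<Rightarrow> real) \<Rightarrow> ('a \<Rightarrow> real)) \<Rightarrow> ('a \<Rightarrow> real) \<Rightarrow> ('a \<Rightarrow> real)" where
  "op_diff S T = (\<lambda>f x. S f x - T f x)"

definition L1_op_le ::
    "'a measure \<Rightarrow> (('a \<Rightarrow> real) \<Rightarrow> ('a \<Rightarrow> real)) \<Rightarrow> (('a \<Rightarrow> real) \<Rightarrow> ('a \<Rightarrow> real)) \<Rightarrow> bool" where
  "L1_op_le M T S \<longleftrightarrow> L1_positive_operator M (op_diff S T)"

definition L1_op_eq ::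
    "'a measure \<Rightarrow> (('a \<Rightarrow> real) \<Rightarrow> ('a \<Rightarrow> real)) \<Rightarrow> (('a \<Rightarrow> real) \<Rightarrow> ('a \<Rightarrow> real)) \<Rightarrow> bool" where
  "L1_op_eq M S T \<longleftrightarrow> (\<forall>f\<in>L1 M. AE x in M. S f x = T f x)"

end

theory Submission
  imports Defs
begin

text \<open>
  The norm of a positive operator is determined on the positive cone, where the norm of \<open>f\<close> is just
  the integral of \<open>f\<close>. So \<open>\<parallel>D\<parallel> \<le> c\<close> for positive \<open>D\<close> means \<open>\<integral>D f \<le> c \<integral>f\<close> for all \<open>f \<ge> 0\<close>
  (\<open>opnorm_le_iff\<close>), and the theorem becomes bookkeeping of mass lost along orbits.

  It suffices to pass from \<open>n\<close> to \<open>n + 1\<close>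
  (\<open>opnorm_op_diff_comp_less_1\<close>). Put \<open>A = S1 S2\<^sup>n\<close> and \<open>B = T1 T2\<^sup>n\<close>, so \<open>B \<le> A\<close>, and let
  \<open>\<parallel>A - B\<parallel> \<le> 1 - \<delta>\<close> with \<open>\<delta> > 0\<close>. Suppose that \<open>f \<ge> 0\<close> has mass at most \<open>1\<close> and that
  \<open>d = \<integral>(A S2 - B T2) f\<close> is close to \<open>1\<close>. Then \<open>A\<close> loses hardly any mass of \<open>S2 f\<close>, hence hardly any of
  the smaller function \<open>g = T2 f\<close>, whereas \<open>B\<close> destroys \<open>g\<close> almost entirely. As \<open>\<parallel>A - B\<parallel> < 1\<close>, this
  is possible only if \<open>g\<close> itself has small mass. Since \<open>n \<ge> 1\<close>, \<open>B f\<close> is the image of \<open>g\<close> under a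
  contraction, so \<open>B f\<close> is small as well; and since \<open>A S2 = S2 A\<close>, \<open>A f\<close> has at least the mass of
  \<open>A S2 f\<close>, which is close to \<open>1\<close>. Thus \<open>\<integral>(A - B) f\<close> is close to \<open>1\<close>, contrary to assumption. Keeping
  track of the constants gives \<open>\<parallel>A S2 - B T2\<parallel> \<le> 1 - \<delta>\<^sup>2 / (1 + \<delta>)\<close>.
\<close>

section \<open>Positive operators and their compositions\<close>

lemma L1_linear_operator_L1:
  assumes "L1_linear_operator M T" "f \<in> L1 M"
  shows "T f \<in> L1 M"
  using assms by (simp add: L1_linear_operator_def)

lemma L1_linear_operator_cong:
  assumes "L1_linear_operator M T" "f \<in> L1 M" "g \<in> L1 M" "AE x in M. f x = g x"
  shows "AE x in M. T f x = T g x"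
  using assms by (simp add: L1_linear_operator_def)

lemma L1_linear_operator_add:
  assumes "L1_linear_operator M T" "f \<in> L1 M" "g \<in> L1 M"
  shows "AE x in M. T (\<lambda>y. f y + g y) x = T f x + T g x"
  using assms by (simp add: L1_linear_operator_def)

lemma L1_linear_operator_scale:
  assumes "L1_linear_operator M T" "f \<in> L1 M"
  shows "AE x in M. T (\<lambda>y. c * f y) x = c * T f x"
  using assms by (simp add: L1_linear_operator_def)

lemma L1_add: "f \<in> L1 M \<Longrightarrow> g \<in> L1 M \<Longrightarrow> (\<lambda>x. f x + g x) \<in> L1 M"
  by (simp add: L1_def)

lemma L1_diff: "f \<in> L1 M \<Longrightarrow> g \<in> L1 M \<Longrightarrow> (\<lambda>x. f x - g x) \<in> L1 M"
  by (simp add: L1_def)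

lemma L1_scale: "f \<in> L1 M \<Longrightarrow> (\<lambda>x. c * f x) \<in> L1 M"
  by (simp add: L1_def)

lemma L1_abs: "f \<in> L1 M \<Longrightarrow> (\<lambda>x. \<bar>f x\<bar>) \<in> L1 M"
  by (simp add: L1_def)

lemma L1_linear_operator_diff:
  assumes T: "L1_linear_operator M T" and fg: "f \<in> L1 M" "g \<in> L1 M"
  shows "AE x in M. T (\<lambda>y. g y - f y) x = T g x - T f x"
  using L1_linear_operator_add[OF T fg(1) L1_diff[OF fg(2,1)]] by (auto elim: AE_mp)

lemma L1_positive_operatorD:
  assumes "L1_positive_operator M T"
  shows "L1_linear_operator M T"
    and "f \<in> L1 M \<Longrightarrow> AE x in M. 0 \<le> f x \<Longrightarrow> AE x in M. 0 \<le> T f x"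
  using assms by (simp_all add: L1_positive_operator_def)

lemma L1_positive_operator_mono:
  assumes T: "L1_positive_operator M T" and fg: "f \<in> L1 M" "g \<in> L1 M"
    and le: "AE x in M. f x \<le> g x"
  shows "AE x in M. T f x \<le> T g x"
proof -
  have "AE x in M. 0 \<le> T (\<lambda>y. g y - f y) x"
    by (rule L1_positive_operatorD(2)[OF T L1_diff[OF fg(2,1)]]) (use le in simp)
  with L1_linear_operator_diff[OF L1_positive_operatorD(1)[OF T] fg]
  show ?thesis by eventually_elim simp
qed

lemma L1_linear_operator_op_diff:
  assumes S: "L1_linear_operator M S" and T: "L1_linear_operator M T"
  shows "L1_linear_operator M (op_diff S T)"
  unfolding L1_linear_operator_def
proof (intro conjI ballI allI impI)
  fix f assume f: "f \<in> L1 M"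
  show "op_diff S T f \<in> L1 M"
    unfolding op_diff_def
    by (intro L1_diff L1_linear_operator_L1[OF S f] L1_linear_operator_L1[OF T f])
  show "AE x in M. op_diff S T (\<lambda>y. c * f y) x = c * op_diff S T f x" for c
    using L1_linear_operator_scale[OF S f, of c] L1_linear_operator_scale[OF T f, of c]
    by eventually_elim (simp add: op_diff_def algebra_simps)
  fix g assume g: "g \<in> L1 M"
  show "AE x in M. op_diff S T (\<lambda>y. f y + g y) x = op_diff S T f x + op_diff S T g x"
    using L1_linear_operator_add[OF S f g] L1_linear_operator_add[OF T f g]
    by eventually_elim (simp add: op_diff_def)
  assume fg: "AE x in M. f x = g x"
  show "AE x in M. op_diff S T f x = op_diff S T g x"
    using L1_linear_operator_cong[OF S f g fg] L1_linear_operator_cong[OF T f g fg]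
    by eventually_elim (simp add: op_diff_def)
qed

lemma L1_op_le_iff:
  assumes "L1_linear_operator M S" "L1_linear_operator M T"
  shows "L1_op_le M T S \<longleftrightarrow>
    (\<forall>f\<in>L1 M. (AE x in M. 0 \<le> f x) \<longrightarrow> (AE x in M. T f x \<le> S f x))"
  using L1_linear_operator_op_diff[OF assms]
  by (simp add: L1_op_le_def L1_positive_operator_def op_diff_def)

lemma L1_positive_operator_comp:
  assumes S: "L1_positive_operator M S" and T: "L1_positive_operator M T"
  shows "L1_positive_operator M (S \<circ> T)"
  unfolding L1_positive_operator_def L1_linear_operator_def
proof (intro conjI ballI allI impI)
  note S' = L1_positive_operatorD(1)[OF S] and T' = L1_positive_operatorD(1)[OF T]
  note T_L1 = L1_linear_operator_L1[OF T']
  fix f assume f: "f \<in> L1 M"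
  show "(S \<circ> T) f \<in> L1 M"
    by (simp add: L1_linear_operator_L1[OF S' T_L1[OF f]])
  show "AE x in M. 0 \<le> (S \<circ> T) f x" if "AE x in M. 0 \<le> f x"
    using L1_positive_operatorD(2)[OF S T_L1[OF f]] L1_positive_operatorD(2)[OF T f that] by simp
  show "AE x in M. (S \<circ> T) (\<lambda>y. c * f y) x = c * (S \<circ> T) f x" for c
    using L1_linear_operator_cong[OF S' T_L1[OF L1_scale[OF f]] L1_scale[OF T_L1[OF f]]
        L1_linear_operator_scale[OF T' f], of c]
      L1_linear_operator_scale[OF S' T_L1[OF f], of c]
    by eventually_elim simp
  fix g assume g: "g \<in> L1 M"
  show "AE x in M. (S \<circ> T) (\<lambda>y. f y + g y) x = (S \<circ> T) f x + (S \<circ> T) g x"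
    using L1_linear_operator_cong[OF S' T_L1[OF L1_add[OF f g]] L1_add[OF T_L1[OF f] T_L1[OF g]]
        L1_linear_operator_add[OF T' f g]]
      L1_linear_operator_add[OF S' T_L1[OF f] T_L1[OF g]]
    by eventually_elim simp
  assume fg: "AE x in M. f x = g x"
  show "AE x in M. (S \<circ> T) f x = (S \<circ> T) g x"
    using L1_linear_operator_cong[OF S' T_L1[OF f] T_L1[OF g] L1_linear_operator_cong[OF T' f g fg]]
    by simp
qed

lemma L1_op_le_comp:
  assumes S: "L1_positive_operator M S" and S': "L1_positive_operator M S'"
    and T: "L1_positive_operator M T" and T': "L1_positive_operator M T'"
    and SS': "L1_op_le M S S'" and TT': "L1_op_le M T T'"
  shows "L1_op_le M (S \<circ> T) (S' \<circ> T')"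
proof -
  note lin = L1_positive_operatorD(1)
  have "AE x in M. S (T f) x \<le> S' (T' f) x" if f: "f \<in> L1 M" "AE x in M. 0 \<le> f x" for f
  proof -
    have Tf: "T f \<in> L1 M" and T'f: "T' f \<in> L1 M"
      using f(1) T T' lin L1_linear_operator_L1 by blast+
    have "AE x in M. T f x \<le> T' f x"
      using TT' f by (simp add: L1_op_le_iff[OF lin[OF T'] lin[OF T]])
    then have "AE x in M. S' (T f) x \<le> S' (T' f) x"
      by (rule L1_positive_operator_mono[OF S' Tf T'f])
    moreover have "AE x in M. S (T f) x \<le> S' (T f) x"
      using SS' Tf L1_positive_operatorD(2)[OF T f]
      by (simp add: L1_op_le_iff[OF lin[OF S'] lin[OF S]])
    ultimately show ?thesis by eventually_elim simp
  qed
  then show ?thesis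
    using L1_op_le_iff[OF L1_positive_operatorD(1)[OF L1_positive_operator_comp[OF S' T']]
        L1_positive_operatorD(1)[OF L1_positive_operator_comp[OF S T]]]
    by simp
qed

section \<open>The norm of a positive operator\<close>

text \<open>
  Since \<open>-\<bar>f\<bar> \<le> f \<le> \<bar>f\<bar>\<close> gives \<open>\<bar>D f\<bar> \<le> D \<bar>f\<bar>\<close>, only \<open>f \<ge> 0\<close> matters; in the other direction
  \<open>f\<close> is normalized, the case of mass \<open>0\<close> being separate.
\<close>

lemma opnorm_le_iff:
  assumes D: "L1_positive_operator M D" and c: "0 \<le> c"
  shows "L1_opnorm M D \<le> ennreal c \<longleftrightarrow>
    (\<forall>f\<in>L1 M. (AE x in M. 0 \<le> f x) \<longrightarrow> (LINT x|M. D f x) \<le> c * (LINT x|M. f x))"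
    (is "_ \<longleftrightarrow> ?R")
proof
  note lin = L1_positive_operatorD(1)[OF D]
  assume norm: "L1_opnorm M D \<le> ennreal c"
  have unit: "L1_norm M (D f) \<le> c" if "f \<in> L1 M" "L1_norm M f \<le> 1" for f
  proof -
    have "ennreal (L1_norm M (D f)) \<le> L1_opnorm M D"
      unfolding L1_opnorm_def using that by (intro SUP_upper) simp
    with norm have "ennreal (L1_norm M (D f)) \<le> ennreal c" by (rule order_trans[rotated])
    then show ?thesis using c by simp
  qed
  show ?R
  proof (intro ballI impI)
    fix f assume f: "f \<in> L1 M" and pos: "AE x in M. 0 \<le> f x"
    define m where "m = (LINT x|M. f x)"
    have m: "0 \<le> m" unfolding m_def using pos by (rule integral_nonneg_AE)
    have scaled: "a * (LINT x|M. D f x) \<le> c" if a: "0 \<le> a" "a * m \<le> 1" for a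
    proof -
      have "AE x in M. \<bar>a * f x\<bar> = a * f x"
        using pos by eventually_elim (use a in simp)
      then have "L1_norm M (\<lambda>y. a * f y) = (LINT x|M. a * f x)"
        unfolding L1_norm_def
        by (intro integral_cong_AE) (use f in \<open>auto simp: L1_def\<close>)
      also have "\<dots> \<le> 1" using a by (simp add: m_def)
      finally have "L1_norm M (D (\<lambda>y. a * f y)) \<le> c" by (rule unit[OF L1_scale[OF f]])
      moreover have "(LINT x|M. D (\<lambda>y. a * f y) x) = (LINT x|M. a * D f x)"
        by (rule integral_cong_AE)
          (use L1_linear_operator_L1[OF lin] f L1_scale[OF f] L1_linear_operator_scale[OF lin f]
            in \<open>auto simp: L1_def\<close>)
      moreover have "(LINT x|M. D (\<lambda>y. a * f y) x) \<le> L1_norm M (D (\<lambda>y. a * f y))"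
        unfolding L1_norm_def
        using L1_linear_operator_L1[OF lin L1_scale[OF f]]
        by (intro integral_mono) (auto simp: L1_def)
      ultimately show ?thesis by simp
    qed
    show "(LINT x|M. D f x) \<le> c * (LINT x|M. f x)"
    proof (cases "m = 0")
      case True
      \<comment> \<open>All multiples of \<open>f\<close> lie in the unit ball, so the mass of \<open>D f\<close> cannot be positive.\<close>
      have "(LINT x|M. D f x) \<le> 0"
      proof (rule ccontr)
        assume "\<not> ?thesis"
        then show False
          using scaled[of "(c + 1) / (LINT x|M. D f x)"] True c by simp
      qed
      with True show ?thesis by (simp add: m_def)
    next
      case False
      with m have "(LINT x|M. D f x) / m \<le> c" using scaled[of "1 / m"] by simp
      with False m show ?thesis by (simp add: m_def[symmetric] field_simps)
    qed
  qed
next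
  note lin = L1_positive_operatorD(1)[OF D]
  assume R: ?R
  have "L1_norm M (D f) \<le> c" if f: "f \<in> L1 M" "L1_norm M f \<le> 1" for f
  proof -
    note Df = L1_linear_operator_L1[OF lin f(1)]
      and Dabs = L1_linear_operator_L1[OF lin L1_abs[OF f(1)]]
    have "AE x in M. D f x \<le> D (\<lambda>x. \<bar>f x\<bar>) x"
      by (rule L1_positive_operator_mono[OF D f(1) L1_abs[OF f(1)]]) simp
    moreover have "AE x in M. D (\<lambda>x. -1 * f x) x \<le> D (\<lambda>x. \<bar>f x\<bar>) x"
      by (rule L1_positive_operator_mono[OF D L1_scale[OF f(1)] L1_abs[OF f(1)]]) simp
    ultimately have "AE x in M. \<bar>D f x\<bar> \<le> D (\<lambda>x. \<bar>f x\<bar>) x"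
      using L1_linear_operator_scale[OF lin f(1), of "-1"] by eventually_elim simp
    then have "L1_norm M (D f) \<le> (LINT x|M. D (\<lambda>x. \<bar>f x\<bar>) x)"
      unfolding L1_norm_def using Df Dabs by (intro integral_mono_AE) (auto simp: L1_def)
    also have "\<dots> \<le> c * L1_norm M f"
      using R L1_abs[OF f(1)] by (simp add: L1_norm_def)
    also have "\<dots> \<le> c" using c f(2) by (simp add: mult_left_le)
    finally show ?thesis .
  qed
  then show "L1_opnorm M D \<le> ennreal c"
    unfolding L1_opnorm_def using c by (intro SUP_least ennreal_leI) simp
qed

lemma L1_positive_contraction_iff:
  "L1_positive_contraction M T \<longleftrightarrow> L1_positive_operator M T \<and>
    (\<forall>f\<in>L1 M. (AE x in M. 0 \<le> f x) \<longrightarrow> (LINT x|M. T f x) \<le> (LINT x|M. f x))"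
  using opnorm_le_iff[of M T 1] by (auto simp: L1_positive_contraction_def)

lemma L1_positive_contraction_comp:
  assumes S: "L1_positive_contraction M S" and T: "L1_positive_contraction M T"
  shows "L1_positive_contraction M (S \<circ> T)"
proof -
  have S': "L1_positive_operator M S" and T': "L1_positive_operator M T"
    using S T by (simp_all add: L1_positive_contraction_def)
  have "(LINT x|M. S (T f) x) \<le> (LINT x|M. f x)" if f: "f \<in> L1 M" "AE x in M. 0 \<le> f x" for f
  proof -
    have "(LINT x|M. S (T f) x) \<le> (LINT x|M. T f x)"
      using S L1_linear_operator_L1[OF L1_positive_operatorD(1)[OF T'] f(1)]
        L1_positive_operatorD(2)[OF T' f]
      by (simp add: L1_positive_contraction_iff)
    also have "\<dots> \<le> (LINT x|M. f x)" using T f by (simp add: L1_positive_contraction_iff)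
    finally show ?thesis .
  qed
  then show ?thesis
    using L1_positive_operator_comp[OF S' T'] by (simp add: L1_positive_contraction_iff)
qed

lemma L1_positive_contraction_id: "L1_positive_contraction M id"
  by (simp add: L1_positive_contraction_iff L1_positive_operator_def L1_linear_operator_def)

lemma L1_positive_contraction_funpow:
  assumes "L1_positive_contraction M T"
  shows "L1_positive_contraction M (T ^^ n)"
proof (induction n)
  case 0
  show ?case using L1_positive_contraction_id by (simp add: id_def)
next
  case (Suc n)
  show ?case using L1_positive_contraction_comp[OF assms Suc] by (simp add: comp_def)
qed

lemma L1_op_le_funpow:
  assumes T: "L1_positive_contraction M T" and S: "L1_positive_contraction M S"
    and TS: "L1_op_le M T S"
  shows "L1_op_le M (T ^^ n) (S ^^ n)"
proof (induction n)
  case 0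
  show ?case
    by (simp add: L1_op_le_def op_diff_def L1_positive_operator_def L1_linear_operator_def L1_def)
next
  case (Suc n)
  have pos: "L1_positive_operator M R" if "L1_positive_contraction M R" for R
    using that by (simp add: L1_positive_contraction_def)
  show ?case
    using L1_op_le_comp[OF pos[OF T] pos[OF S] pos[OF L1_positive_contraction_funpow[OF T]]
        pos[OF L1_positive_contraction_funpow[OF S]] TS Suc]
    by (simp add: comp_def)
qed

section \<open>Strict contractivity of a difference survives one more factor\<close>

text \<open>
  Here \<open>B = C T\<close> with a contraction \<open>C\<close>: this makes \<open>B f\<close> small as soon as \<open>T f\<close> is. Commutation
  enters through \<open>\<integral>A S f = \<integral>S A f \<le> \<integral>A f\<close>.
\<close>

lemma opnorm_op_diff_comp_less_1:
  assumes A: "L1_positive_contraction M A" and S: "L1_positive_contraction M S"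
    and C: "L1_positive_contraction M C" and T: "L1_positive_contraction M T"
    and TS: "L1_op_le M T S" and BA: "L1_op_le M (C \<circ> T) A"
    and comm: "L1_op_eq M (A \<circ> S) (S \<circ> A)"
    and less: "L1_opnorm M (op_diff A (C \<circ> T)) < 1"
  shows "L1_opnorm M (op_diff (A \<circ> S) (C \<circ> T \<circ> T)) < 1"
proof -
  let ?I = "\<lambda>f. LINT x|M. f x"
  define B where "B = C \<circ> T"
  have B: "L1_positive_contraction M B"
    unfolding B_def by (rule L1_positive_contraction_comp[OF C T])
  have pos: "L1_positive_operator M R" if "L1_positive_contraction M R" for R
    using that by (simp add: L1_positive_contraction_def)
  have lin: "L1_linear_operator M R" if "L1_positive_contraction M R" for R
    using L1_positive_operatorD(1)[OF pos[OF that]] .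
  have L1: "R f \<in> L1 M" if "L1_positive_contraction M R" "f \<in> L1 M" for R f
    using L1_linear_operator_L1[OF lin] that by blast
  have int_le: "?I (R f) \<le> ?I f"
    if "L1_positive_contraction M R" "f \<in> L1 M" "AE x in M. 0 \<le> f x" for R f
    using that by (simp add: L1_positive_contraction_iff)
  have int_op_diff: "?I (op_diff P Q f) = ?I (P f) - ?I (Q f)"
    if "P f \<in> L1 M" "Q f \<in> L1 M" for P Q f
    using that by (simp add: op_diff_def L1_def)
  have AB_pos: "L1_positive_operator M (op_diff A B)"
    using BA by (simp add: B_def L1_op_le_def)
  have ASBT_pos: "L1_positive_operator M (op_diff (A \<circ> S) (B \<circ> T))"
    using L1_op_le_comp[OF pos[OF B] pos[OF A] pos[OF T] pos[OF S] _ TS] BA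
    by (simp add: B_def L1_op_le_def)
  obtain c where c: "0 \<le> c" "c < 1" "L1_opnorm M (op_diff A B) = ennreal c"
    using less by (cases "L1_opnorm M (op_diff A (C \<circ> T))") (auto simp: B_def)
  define \<delta> where "\<delta> = 1 - c"
  have \<delta>: "0 < \<delta>" "\<delta> \<le> 1" using c by (simp_all add: \<delta>_def)
  have gap: "?I (A f) - ?I (B f) \<le> (1 - \<delta>) * ?I f"
    if f: "f \<in> L1 M" "AE x in M. 0 \<le> f x" for f
  proof -
    have "?I (op_diff A B f) \<le> c * ?I f"
      using opnorm_le_iff[OF AB_pos c(1)] c(3) f by simp
    then show ?thesis
      using int_op_diff[of A f B] L1[OF A f(1)] L1[OF B f(1)] by (simp add: \<delta>_def)
  qed
  define c' where "c' = 1 - \<delta>\<^sup>2 / (1 + \<delta>)"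
  have "\<delta>\<^sup>2 \<le> 1" using \<delta> by (simp add: power_le_one)
  then have "\<delta>\<^sup>2 \<le> 1 + \<delta>" using \<delta> by linarith
  then have c': "0 \<le> c'" "c' < 1" using \<delta> by (simp_all add: c'_def)
  have "?I (op_diff (A \<circ> S) (B \<circ> T) f) \<le> c' * ?I f"
    if f: "f \<in> L1 M" "AE x in M. 0 \<le> f x" for f
  proof -
    define m where "m = ?I f"
    define g where "g = T f"
    define d where "d = ?I (A (S f)) - ?I (B g)"
    have g: "g \<in> L1 M" "AE x in M. 0 \<le> g x"
      unfolding g_def using L1[OF T f(1)] L1_positive_operatorD(2)[OF pos[OF T] f] by blast+
    note Sf = L1[OF S f(1)]
    have "AE x in M. 0 \<le> S f x - g x"
      using TS f by (simp add: g_def L1_op_le_iff[OF lin[OF S] lin[OF T]])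
    \<comment> \<open>\<open>A\<close> takes no more mass from \<open>g\<close> than from \<open>S f \<ge> g\<close>.\<close>
    then have "?I (A (\<lambda>x. S f x - g x)) \<le> ?I (\<lambda>x. S f x - g x)"
      by (rule int_le[OF A L1_diff[OF Sf g(1)]])
    moreover have "?I (A (\<lambda>x. S f x - g x)) = ?I (\<lambda>x. A (S f) x - A g x)"
      using L1_linear_operator_diff[OF lin[OF A] g(1) Sf] L1[OF A L1_diff[OF Sf g(1)]]
        L1[OF A Sf] L1[OF A g(1)]
      by (intro integral_cong_AE) (auto simp: L1_def)
    ultimately have "?I (A (S f)) - ?I (A g) \<le> ?I (S f) - ?I g"
      using L1[OF A Sf] L1[OF A g(1)] Sf g(1) by (simp add: L1_def)
    also have "\<dots> \<le> m - ?I g" using int_le[OF S f] by (simp add: m_def)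
    finally have "?I g - (m - d) \<le> ?I (A g) - ?I (B g)" by (simp add: d_def)
    with gap[OF g] have g_small: "\<delta> * ?I g \<le> m - d" by (simp add: algebra_simps)
    have "?I (A (S f)) = ?I (S (A f))"
      using comm f(1) L1[OF A Sf] L1[OF S L1[OF A f(1)]]
      by (intro integral_cong_AE) (auto simp: L1_op_eq_def L1_def)
    also have "\<dots> \<le> ?I (A f)"
      by (rule int_le[OF S L1[OF A f(1)] L1_positive_operatorD(2)[OF pos[OF A] f]])
    finally have "?I (A (S f)) \<le> ?I (A f)" .
    moreover have "?I (B f) \<le> ?I g"
      using int_le[OF C g] by (simp add: B_def g_def)
    moreover have "0 \<le> ?I (B g)"
      by (rule integral_nonneg_AE[OF L1_positive_operatorD(2)[OF pos[OF B] g]])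
    ultimately have "d - ?I g \<le> (1 - \<delta>) * m"
      using gap[OF f] by (simp add: d_def m_def)
    then have "\<delta> * (d - ?I g) \<le> \<delta> * ((1 - \<delta>) * m)"
      using \<delta> by (intro mult_left_mono) simp_all
    with g_small have "d * (1 + \<delta>) \<le> m * (1 + \<delta> - \<delta>\<^sup>2)"
      by (simp add: algebra_simps power2_eq_square)
    then have "d \<le> m * (1 + \<delta> - \<delta>\<^sup>2) / (1 + \<delta>)"
      using \<delta> by (simp add: pos_le_divide_eq)
    also have "\<dots> = c' * m" using \<delta> by (simp add: c'_def field_simps)
    finally show ?thesis
      using int_op_diff[of "A \<circ> S" f "B \<circ> T"] L1[OF A Sf] L1[OF B g(1)]
      by (simp add: d_def m_def g_def)
  qed
  then have "L1_opnorm M (op_diff (A \<circ> S) (B \<circ> T)) \<le> ennreal c'"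
    by (simp add: opnorm_le_iff[OF ASBT_pos c'(1)])
  also have "\<dots> < 1" using c' by simp
  finally show ?thesis by (simp add: B_def)
qed

theorem theorem2p1:
  fixes M :: "'a measure"
    and T1 T2 S1 S2 :: "('a \<Rightarrow> real) \<Rightarrow> ('a \<Rightarrow> real)"
    and n0 :: nat
  assumes "L1_positive_contraction M T1" and "L1_positive_contraction M T2"
    and "L1_positive_contraction M S1" and "L1_positive_contraction M S2"
    and "L1_op_le M T1 S1" and "L1_op_le M T2 S2"
    and "L1_op_eq M (S1 \<circ> S2) (S2 \<circ> S1)"
    and "n0 \<ge> 1"
    and "L1_opnorm M (op_diff (S1 \<circ> (S2 ^^ n0)) (T1 \<circ> (T2 ^^ n0))) < 1"
  shows "\<forall>n\<ge>n0. L1_opnorm M (op_diff (S1 \<circ> (S2 ^^ n)) (T1 \<circ> (T2 ^^ n))) < 1"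
proof (intro allI impI)
  fix n assume "n \<ge> n0"
  then show "L1_opnorm M (op_diff (S1 \<circ> (S2 ^^ n)) (T1 \<circ> (T2 ^^ n))) < 1"
  proof (induction n rule: dec_induct)
    case base
    show ?case by (fact assms(9))
  next
    case (step n)
    from step(1) \<open>n0 \<ge> 1\<close> obtain k where k: "n = Suc k" by (cases n) auto
    let ?A = "S1 \<circ> S2 ^^ n" and ?C = "T1 \<circ> T2 ^^ k"
    have pow: "R ^^ Suc j = R ^^ j \<circ> R" for R :: "('a \<Rightarrow> real) \<Rightarrow> ('a \<Rightarrow> real)" and j
      by (rule funpow_Suc_right)
    have CT: "?C \<circ> T2 = T1 \<circ> T2 ^^ n"
      by (simp only: k pow comp_assoc)
    have "L1_op_le M (T1 \<circ> T2 ^^ n) ?A"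
      using assms(1-6) L1_positive_contraction_funpow[OF assms(2)]
        L1_positive_contraction_funpow[OF assms(4)] L1_op_le_funpow[OF assms(2,4,6)]
      by (intro L1_op_le_comp) (simp_all add: L1_positive_contraction_def)
    moreover have "L1_op_eq M (?A \<circ> S2) (S2 \<circ> ?A)"
      unfolding L1_op_eq_def
    proof
      fix f assume "f \<in> L1 M"
      then have "(S2 ^^ n) f \<in> L1 M"
        using L1_positive_contraction_funpow[OF assms(4)]
        by (simp add: L1_positive_contraction_def L1_positive_operator_def L1_linear_operator_L1)
      with assms(7) show "AE x in M. (?A \<circ> S2) f x = (S2 \<circ> ?A) f x"
        by (simp add: L1_op_eq_def funpow_swap1[symmetric])
    qed
    ultimately have "L1_opnorm M (op_diff (?A \<circ> S2) (?C \<circ> T2 \<circ> T2)) < 1"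
      using assms(2,4,6) step.IH
      by (intro opnorm_op_diff_comp_less_1)
        (simp_all only: CT L1_positive_contraction_comp[OF assms(3)]
          L1_positive_contraction_comp[OF assms(1)] L1_positive_contraction_funpow)
    then show ?case unfolding CT by (simp only: pow comp_assoc)
  qed
qed

end
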